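(* Let $Q\in\mathcal{P}$ and let $\mathcal{G}$ be the set of strictly positive functions in $\bigcap_{i=1}^d L_1(Q_i)\cap L_1(Q)$. The following conditions are equivalent: (1) The set of equivalent martingale measures is a singleton, i.e. $\mathcal{P}=\{Q\}$. (2) If $g\in\mathcal{G}$ and if $E_{Q'_i(t)}[g\,|\,\mathcal{F}_t]=E_Q[g\,|\,\mathcal{F}_t]$ (almost surely) holds for all $1\le i\le d$ and $t\in I$, then $g$ is constant $Q$-almost surely.
   Context: Fix $0<T<\infty$, a set $I\subset[0,T]$ with $\{0,T\}\subset I$, and a probability space $(\Omega,\mathcal{F},P)$ with a filtration $(\mathcal{F}_t)_{t\in I}$ such that $\mathcal{F}=\sigma(\mathcal{F}_t:t\in I)$ and $\mathcal{F}_0=\sigma(\{N\in\mathcal{F}:P(N)=0\text{ or }P(N)=1\})$. Let $(X^i_t)_{t\in I}$, $1\le i\le d$, be adapted (strictly) positive discounted price processes. $\mathcal{P}$ denotes the set of all martingale measures equivalent to $P$, i.e. probability measures $Q$ equivalent to $P$ such that $(X^i_t)_{t\in I}$ is a $Q$-martingale for each $1\le i\le d$. For $Q\in\mathcal{P}$, let $Q_i$ be the probability measure given by $\frac{dQ_i}{dQ}=\frac{X^i_T}{X^i_0}$. For $t\in I$ the complementary measures $Q'_i(t)$, defined through the factorization $\frac{dQ_i}{dQ}=\frac{dQ'_i(t)}{dQ}\cdot\frac{dQ_{i|\mathcal{F}_t}}{dQ_{|\mathcal{F}_t}}$, are the probability measures with $$\frac{dQ'_i(t)}{dQ}=\frac{X^i_T}{X^i_t}.$$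 Conditional expectations of nonnegative functions are understood in the usual extended sense, with values in $[0,\infty]$. *)

theory Defs
  imports "HOL-Probability.Probability"
begin

text \<open>
  A sub-sigma-algebra \<open>F t\<close> of \<open>M\<close> is given as a measure, of which only
  \<open>space\<close> and \<open>sets\<close> matter (as in \<^theory>\<open>HOL-Probability.Conditional_Expectation\<close>).
  The library locale \<open>filtration\<close> is indexed by a whole type; here the index set is
  an arbitrary set of times.
\<close>

definition filtration_on :: "real set \<Rightarrow> 'a measure \<Rightarrow> (real \<Rightarrow> 'a measure) \<Rightarrow> bool" where
  "filtration_on I M F \<longleftrightarrow>
     (\<forall>t\<in>I. subalgebra M (F t)) \<and>
     (\<forall>s\<in>I. \<forall>t\<in>I. s \<le> t \<longrightarrow> sets (F s) \<subseteq> sets (F t))"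

definition adapted_on ::
    "real set \<Rightarrow> (real \<Rightarrow> 'a measure) \<Rightarrow> (real \<Rightarrow> 'a \<Rightarrow> real) \<Rightarrow> bool" where
  "adapted_on I F Y \<longleftrightarrow> (\<forall>t\<in>I. Y t \<in> borel_measurable (F t))"

definition martingale_on ::
    "real set \<Rightarrow> 'a measure \<Rightarrow> (real \<Rightarrow> 'a measure) \<Rightarrow> (real \<Rightarrow> 'a \<Rightarrow> real) \<Rightarrow> bool" where
  "martingale_on I Q F Y \<longleftrightarrow>
     adapted_on I F Y \<and>
     (\<forall>t\<in>I. integrable Q (Y t)) \<and>
     (\<forall>s\<in>I. \<forall>t\<in>I. s \<le> t \<longrightarrow> (AE \<omega> in Q. real_cond_exp Q (F s) (Y t) \<omega> = Y s \<omega>))"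

definition equivalent_measures :: "'a measure \<Rightarrow> 'a measure \<Rightarrow> bool" where
  "equivalent_measures P Q \<longleftrightarrow>
     sets Q = sets P \<and> absolutely_continuous P Q \<and> absolutely_continuous Q P"

definition martingale_measures ::
    "real set \<Rightarrow> 'a measure \<Rightarrow> (real \<Rightarrow> 'a measure) \<Rightarrow> nat \<Rightarrow> (nat \<Rightarrow> real \<Rightarrow> 'a \<Rightarrow> real)
      \<Rightarrow> 'a measure set" where
  "martingale_measures I P F d X =
     {Q. prob_space Q \<and> equivalent_measures P Q \<and> (\<forall>i\<in>{1..d}. martingale_on I Q F (X i))}"

text \<open>
  The arguments \<open>Y\<close> of the next two definitions are single price processes \<open>X i\<close>.
  Division by zero and the truncation of negative values by \<^const>\<open>ennreal\<close> do not
  occur for strictly positive \<open>Y\<close>. If \<open>Y\<close> is moreover a \<open>Q\<close>-martingale and, for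
  \<open>numeraire_measure\<close>, \<open>Y 0\<close> is \<open>Q\<close>-almost surely constant, both are probability
  measures.
\<close>

definition numeraire_measure ::
    "real \<Rightarrow> 'a measure \<Rightarrow> (real \<Rightarrow> 'a \<Rightarrow> real) \<Rightarrow> 'a measure" where
  "numeraire_measure T Q Y = density Q (\<lambda>\<omega>. ennreal (Y T \<omega> / Y 0 \<omega>))"

text \<open>
  The density \<open>Y T / Y t\<close> is the factor left over when \<open>Y T / Y 0\<close> is divided by
  \<open>Y t / Y 0\<close>, the density of \<open>numeraire_measure T Q Y\<close> relative to \<open>Q\<close> on \<open>F t\<close>.
\<close>

definition complementary_measure ::
    "real \<Rightarrow> 'a measure \<Rightarrow> (real \<Rightarrow> 'a \<Rightarrow> real) \<Rightarrow> real \<Rightarrow> 'a measure" where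
  "complementary_measure T Q Y t = density Q (\<lambda>\<omega>. ennreal (Y T \<omega> / Y t \<omega>))"

definition positive_integrands ::
    "real \<Rightarrow> 'a measure \<Rightarrow> nat \<Rightarrow> (nat \<Rightarrow> real \<Rightarrow> 'a \<Rightarrow> real) \<Rightarrow> ('a \<Rightarrow> real) set" where
  "positive_integrands T Q d X =
     {g. (\<forall>\<omega>\<in>space Q. 0 < g \<omega>) \<and> integrable Q g \<and>
         (\<forall>i\<in>{1..d}. integrable (numeraire_measure T Q (X i)) g)}"

end

theory Submission
  imports Defs
begin

text \<open>
  The equivalent martingale measures are described through their densities. Let \<open>g > 0\<close> be
  \<open>Q\<close>-integrable with mean \<open>m\<close>, and let \<open>R\<close> have density \<open>g / m\<close> with respect to \<open>Q\<close>; every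
  probability measure equivalent to \<open>P\<close> arises in this way, and \<open>R = Q\<close> exactly if \<open>g\<close> is
  \<open>Q\<close>-almost surely constant. Write \<open>Y\<close> for one of the price processes. Since \<open>T\<close> is the last
  time, \<open>Y\<close> is an \<open>R\<close>-martingale iff \<open>Y T\<close> is \<open>R\<close>-integrable and the conditional expectation of
  \<open>Y T\<close> under \<open>R\<close> given \<open>F t\<close> is \<open>Y t\<close> for all \<open>t\<close> (\<open>martingale_on_iff_closed\<close>).

  The core is that Bayes' formula (\<open>nn_cond_exp_density\<close>) can be read in two ways. Applied to
  the density \<open>g / m\<close> it turns the closing condition for \<open>R\<close> into
  \<open>E_Q[g * Y T | F t] = Y t * E_Q[g | F t]\<close>,
  and applied to the density \<open>Y T / Y t\<close> of the complementary measure, whose conditional mean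
  given \<open>F t\<close> is one because \<open>Y\<close> is a \<open>Q\<close>-martingale, it turns the equality of the two
  conditional expectations of \<open>g\<close> into the same identity. The roles of \<open>g\<close> and \<open>Y T\<close> are
  interchanged, but the product is the same. Hence \<open>R\<close> is a martingale measure iff all
  \<open>X i T * g\<close> are \<open>Q\<close>-integrable and \<open>g\<close> satisfies the condition on complementary measures
  (\<open>normalized_density_martingale_measure_iff\<close>).

  The triviality of \<open>F 0\<close> makes the initial prices constant, so that integrability of
  \<open>X i T * g\<close> under \<open>Q\<close> is integrability of \<open>g\<close> under the numeraire measure. Thus the functions
  \<open>g\<close> considered in the second condition are, up to scaling, precisely the positive densities of
  equivalent martingale measures, and their being constant is the uniqueness of \<open>Q\<close>.
\<close>

section \<open>Conditional expectations under a change of measure\<close>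

text \<open>
  Martingales are defined through the real-valued conditional expectation, complementary
  measures through the extended one; on nonnegative integrable functions both agree because the
  extended one is almost surely finite.
\<close>

lemma (in sigma_finite_subalgebra) nn_cond_exp_eq_real_cond_exp:
  assumes f: "integrable M f" and nonneg: "AE x in M. 0 \<le> f x"
  shows "AE x in M. nn_cond_exp M F (\<lambda>x. ennreal (f x)) x = ennreal (real_cond_exp M F f x)"
proof -
  have [measurable]: "f \<in> borel_measurable M" using f by simp
  have "(\<integral>\<^sup>+x. nn_cond_exp M F (\<lambda>x. ennreal (f x)) x \<partial>M) = (\<integral>\<^sup>+x. ennreal (f x) \<partial>M)"
    using nn_cond_exp_intg[of "\<lambda>_. 1" "\<lambda>x. ennreal (f x)"] by simp
  also have "\<dots> \<noteq> \<infinity>"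
    using f nonneg by (simp add: nn_integral_eq_integral)
  finally have fin: "AE x in M. nn_cond_exp M F (\<lambda>x. ennreal (f x)) x \<noteq> \<infinity>"
    by (intro nn_integral_PInf_AE) auto
  have "AE x in M. nn_cond_exp M F (\<lambda>x. ennreal (- f x)) x = nn_cond_exp M F (\<lambda>_. 0) x"
    using nonneg by (intro nn_cond_exp_cong) (auto simp: ennreal_neg)
  moreover have "AE x in M. 0 = nn_cond_exp M F (\<lambda>_. 0) x"
    by (rule nn_cond_exp_F_meas) simp
  ultimately have "AE x in M. nn_cond_exp M F (\<lambda>x. ennreal (- f x)) x = 0"
    by eventually_elim simp
  with fin show ?thesis
    by eventually_elim (simp add: real_cond_exp_def less_top)
qed

text \<open>
  Bayes' formula for conditional expectations, in a form without division. Both sides have the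
  same integral over every set of \<open>F\<close>: the conditional expectation of \<open>f\<close> under \<open>density M h\<close>
  is \<open>F\<close>-measurable, so against it \<open>h\<close> may be replaced by its own conditional expectation.
\<close>

lemma nn_cond_exp_density:
  assumes F: "sigma_finite_subalgebra M F" and F': "sigma_finite_subalgebra (density M h) F"
    and [measurable]: "h \<in> borel_measurable M" "f \<in> borel_measurable M"
  shows "AE x in M. nn_cond_exp (density M h) F f x * nn_cond_exp M F h x
                  = nn_cond_exp M F (\<lambda>x. h x * f x) x"
proof -
  interpret sigma_finite_subalgebra M F by fact
  interpret N: sigma_finite_subalgebra "density M h" F by fact
  let ?e = "nn_cond_exp (density M h) F f"
  have [measurable]: "?e \<in> borel_measurable M" by (rule measurable_from_subalg[OF subalg]) simp
  show ?thesis
  proof (rule nn_cond_exp_charact)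
    fix A assume A [measurable]: "A \<in> sets F"
    then have [measurable]: "A \<in> sets M" using subalg by (auto simp: subalgebra_def)
    have "(\<integral>\<^sup>+x\<in>A. (h x * f x) \<partial>M) = (\<integral>\<^sup>+x. indicator A x * f x \<partial>density M h)"
      by (subst nn_integral_density) (auto intro!: nn_integral_cong simp: mult_ac)
    also have "\<dots> = (\<integral>\<^sup>+x. indicator A x * ?e x \<partial>density M h)"
      by (rule N.nn_cond_exp_intg[symmetric]) auto
    also have "\<dots> = (\<integral>\<^sup>+x. (indicator A x * ?e x) * h x \<partial>M)"
      by (subst nn_integral_density) (auto intro!: nn_integral_cong simp: mult_ac)
    also have "\<dots> = (\<integral>\<^sup>+x. (indicator A x * ?e x) * nn_cond_exp M F h x \<partial>M)"
      by (rule nn_cond_exp_intg[symmetric]) auto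
    also have "\<dots> = (\<integral>\<^sup>+x\<in>A. (?e x * nn_cond_exp M F h x) \<partial>M)"
      by (auto intro!: nn_integral_cong simp: mult_ac)
    finally show "(\<integral>\<^sup>+x\<in>A. (h x * f x) \<partial>M) = (\<integral>\<^sup>+x\<in>A. (?e x * nn_cond_exp M F h x) \<partial>M)" .
  qed auto
qed

lemma AE_iff_cong:
  assumes "AE x in M. P x \<longleftrightarrow> P' x"
  shows "(AE x in M. P x) \<longleftrightarrow> (AE x in M. P' x)"
  using assms by (auto elim: eventually_elim2)

lemma AE_density_pos:
  fixes g :: "'a \<Rightarrow> real"
  assumes [measurable]: "g \<in> borel_measurable M" and "\<And>x. x \<in> space M \<Longrightarrow> 0 < g x"
  shows "(AE x in density M (\<lambda>x. ennreal (g x)). P x) \<longleftrightarrow> (AE x in M. P x)"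
proof -
  have "(AE x in density M (\<lambda>x. ennreal (g x)). P x) \<longleftrightarrow> (AE x in M. 0 < ennreal (g x) \<longrightarrow> P x)"
    by (rule AE_density) simp
  also have "\<dots> \<longleftrightarrow> (AE x in M. P x)"
    using assms(2) by (intro AE_cong) simp
  finally show ?thesis .
qed

text \<open>
  First reading of Bayes' formula: multiply by the conditional expectation of \<open>g\<close>, which lies
  strictly between zero and infinity. The normalizing constant \<open>m\<close> cancels, so the resulting
  condition is stated for \<open>g\<close> itself; this makes it insensitive to scaling.
\<close>

lemma cond_exp_normalized_density_eq_iff:
  fixes Y Z g :: "'a \<Rightarrow> real"
  assumes "prob_space Q" and sub: "subalgebra Q F"
    and [measurable]: "Z \<in> borel_measurable Q"
    and g: "integrable Q g" and g_pos: "\<And>x. x \<in> space Q \<Longrightarrow> 0 < g x" and "0 < m"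
    and "prob_space (density Q (\<lambda>x. ennreal (g x / m)))" (is "prob_space ?R")
  shows "(AE x in ?R. nn_cond_exp ?R F (\<lambda>x. ennreal (Z x)) x = ennreal (Y x))
     \<longleftrightarrow> (AE x in Q. nn_cond_exp Q F (\<lambda>x. ennreal (g x) * ennreal (Z x)) x
            = ennreal (Y x) * nn_cond_exp Q F (\<lambda>x. ennreal (g x)) x)"
proof -
  interpret Q: prob_space Q by fact
  interpret R: prob_space ?R by fact
  interpret QF: finite_measure_subalgebra Q F
    using sub by unfold_locales
  interpret RF: finite_measure_subalgebra ?R F
    using sub by unfold_locales (simp add: subalgebra_def)
  have [measurable]: "g \<in> borel_measurable Q" using g by simp
  let ?eR = "nn_cond_exp ?R F (\<lambda>x. ennreal (Z x))"
  let ?eg = "nn_cond_exp Q F (\<lambda>x. ennreal (g x))"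
  let ?egZ = "nn_cond_exp Q F (\<lambda>x. ennreal (g x) * ennreal (Z x))"
  have scale: "ennreal (g x / m) = ennreal (1 / m) * ennreal (g x)" if "x \<in> space Q" for x
    using \<open>0 < m\<close> g_pos[OF that] by (simp add: ennreal_mult[symmetric])
  have "AE x in Q. ?eR x * nn_cond_exp Q F (\<lambda>x. ennreal (g x / m)) x
      = nn_cond_exp Q F (\<lambda>x. ennreal (g x / m) * ennreal (Z x)) x"
    by (rule nn_cond_exp_density) (auto intro: QF.sigma_finite_subalgebra_axioms RF.sigma_finite_subalgebra_axioms)
  moreover have "AE x in Q. nn_cond_exp Q F (\<lambda>x. ennreal (g x / m)) x
      = nn_cond_exp Q F (\<lambda>x. ennreal (1 / m) * ennreal (g x)) x"
    by (rule QF.nn_cond_exp_cong) (auto simp: scale)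
  moreover have "AE x in Q. nn_cond_exp Q F (\<lambda>x. ennreal (g x / m) * ennreal (Z x)) x
      = nn_cond_exp Q F (\<lambda>x. ennreal (1 / m) * (ennreal (g x) * ennreal (Z x))) x"
    by (rule QF.nn_cond_exp_cong) (auto simp: scale mult.assoc)
  moreover have "AE x in Q. ennreal (1 / m) * ?eg x = nn_cond_exp Q F (\<lambda>x. ennreal (1 / m) * ennreal (g x)) x"
    by (rule QF.nn_cond_exp_prod) auto
  moreover have "AE x in Q. ennreal (1 / m) * ?egZ x
      = nn_cond_exp Q F (\<lambda>x. ennreal (1 / m) * (ennreal (g x) * ennreal (Z x))) x"
    by (rule QF.nn_cond_exp_prod) auto
  ultimately have bayes: "AE x in Q. ennreal (1 / m) * (?eR x * ?eg x) = ennreal (1 / m) * ?egZ x"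
  proof eventually_elim
    case (elim x)
    have "ennreal (1 / m) * (?eR x * ?eg x) = ?eR x * (ennreal (1 / m) * ?eg x)"
      by (rule mult.left_commute)
    also have "\<dots> = ennreal (1 / m) * ?egZ x" using elim by simp
    finally show ?case .
  qed
  have "AE x in Q. ?eg x = ennreal (real_cond_exp Q F g x)"
    using g_pos by (intro QF.nn_cond_exp_eq_real_cond_exp[OF g]) (auto intro: less_imp_le)
  moreover have "AE x in Q. 0 < real_cond_exp Q F g x"
    using g_pos by (intro QF.real_cond_exp_gr_c[OF g]) auto
  ultimately have "AE x in Q. ?eg x \<noteq> 0 \<and> ?eg x \<noteq> top"
    by eventually_elim simp
  with bayes have "AE x in Q. ?eR x = ennreal (Y x) \<longleftrightarrow> ?egZ x = ennreal (Y x) * ?eg x"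
  proof eventually_elim
    case (elim x)
    then have "?eR x * ?eg x = ?egZ x"
      using \<open>0 < m\<close> by (simp add: ennreal_mult_cancel_left)
    then have "?egZ x = ennreal (Y x) * ?eg x \<longleftrightarrow> ?eg x * ?eR x = ?eg x * ennreal (Y x)"
      by (simp only: mult.commute[of "?eg x"] flip: \<open>?eR x * ?eg x = ?egZ x\<close>)
    also have "\<dots> \<longleftrightarrow> ?eR x = ennreal (Y x)"
      using elim(2) by (simp add: ennreal_mult_cancel_left)
    finally show ?case by blast
  qed
  then have "(AE x in Q. ?eR x = ennreal (Y x)) \<longleftrightarrow> (AE x in Q. ?egZ x = ennreal (Y x) * ?eg x)"
    by (rule AE_iff_cong)
  then show ?thesis
    using g_pos \<open>0 < m\<close> by (simp add: AE_density_pos)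
qed

text \<open>
  Second reading of Bayes' formula: if \<open>Y\<close> is the conditional expectation of \<open>Z\<close>, then the
  density \<open>Z / Y\<close> has conditional expectation one, so the conditional expectation of \<open>g\<close> under
  the new measure is just that of \<open>g * Z / Y\<close> under \<open>Q\<close>, and \<open>Y\<close> can be pulled out.
\<close>

lemma complementary_cond_exp_eq_iff:
  fixes Y Z :: "'a \<Rightarrow> real"
  assumes "prob_space Q" and sub: "subalgebra Q F"
    and [measurable]: "Z \<in> borel_measurable Q" "Y \<in> borel_measurable F" "g \<in> borel_measurable Q"
    and Z_nonneg: "\<And>x. x \<in> space Q \<Longrightarrow> 0 \<le> Z x" and Y_pos: "\<And>x. x \<in> space Q \<Longrightarrow> 0 < Y x"
    and Z: "AE x in Q. nn_cond_exp Q F (\<lambda>x. ennreal (Z x)) x = ennreal (Y x)"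
  shows "(AE x in Q. nn_cond_exp (density Q (\<lambda>x. ennreal (Z x / Y x))) F g x = nn_cond_exp Q F g x)
     \<longleftrightarrow> (AE x in Q. nn_cond_exp Q F (\<lambda>x. g x * ennreal (Z x)) x = ennreal (Y x) * nn_cond_exp Q F g x)"
    (is "(AE x in Q. nn_cond_exp ?N F g x = _) \<longleftrightarrow> _")
proof -
  interpret Q: prob_space Q by fact
  interpret QF: finite_measure_subalgebra Q F
    using sub by unfold_locales
  have [measurable]: "Y \<in> borel_measurable Q" by (rule measurable_from_subalg[OF sub]) simp
  have quot: "ennreal (Z x / Y x) = ennreal (1 / Y x) * ennreal (Z x)" if "x \<in> space Q" for x
    using Y_pos[OF that] Z_nonneg[OF that] by (simp add: ennreal_mult[symmetric])
  have "AE x in Q. ennreal (1 / Y x) * nn_cond_exp Q F (\<lambda>x. ennreal (Z x)) x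
      = nn_cond_exp Q F (\<lambda>x. ennreal (1 / Y x) * ennreal (Z x)) x"
    by (rule QF.nn_cond_exp_prod) auto
  moreover have "AE x in Q. nn_cond_exp Q F (\<lambda>x. ennreal (Z x / Y x)) x
      = nn_cond_exp Q F (\<lambda>x. ennreal (1 / Y x) * ennreal (Z x)) x"
    by (rule QF.nn_cond_exp_cong) (auto simp: quot)
  ultimately have one: "AE x in Q. nn_cond_exp Q F (\<lambda>x. ennreal (Z x / Y x)) x = 1"
    using Z AE_space
    by eventually_elim (use Y_pos in \<open>simp add: ennreal_mult[symmetric] less_imp_le less_imp_neq[symmetric]\<close>)
  have "(\<integral>\<^sup>+x. ennreal (Z x / Y x) \<partial>Q) = (\<integral>\<^sup>+x. nn_cond_exp Q F (\<lambda>x. ennreal (Z x / Y x)) x \<partial>Q)"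
    using QF.nn_cond_exp_intg[of "\<lambda>_. 1" "\<lambda>x. ennreal (Z x / Y x)"] by simp
  also have "\<dots> = (\<integral>\<^sup>+x. 1 \<partial>Q)"
    by (rule nn_integral_cong_AE) (rule one)
  finally have "(\<integral>\<^sup>+x. ennreal (Z x / Y x) \<partial>Q) = 1" by (simp add: Q.emeasure_space_1)
  then interpret N: prob_space ?N
    by (intro prob_spaceI) (simp add: emeasure_density cong: nn_integral_cong)
  interpret NF: finite_measure_subalgebra ?N F
    using sub by unfold_locales (simp add: subalgebra_def)
  have "AE x in Q. nn_cond_exp ?N F g x * nn_cond_exp Q F (\<lambda>x. ennreal (Z x / Y x)) x
      = nn_cond_exp Q F (\<lambda>x. ennreal (Z x / Y x) * g x) x"
    by (rule nn_cond_exp_density) (auto intro: QF.sigma_finite_subalgebra_axioms NF.sigma_finite_subalgebra_axioms)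
  moreover have "AE x in Q. nn_cond_exp Q F (\<lambda>x. ennreal (Z x / Y x) * g x) x
      = nn_cond_exp Q F (\<lambda>x. ennreal (1 / Y x) * (g x * ennreal (Z x))) x"
    by (rule QF.nn_cond_exp_cong) (auto simp: quot mult_ac)
  moreover have "AE x in Q. ennreal (1 / Y x) * nn_cond_exp Q F (\<lambda>x. g x * ennreal (Z x)) x
      = nn_cond_exp Q F (\<lambda>x. ennreal (1 / Y x) * (g x * ennreal (Z x))) x"
    by (rule QF.nn_cond_exp_prod) auto
  ultimately have "AE x in Q. nn_cond_exp ?N F g x
      = ennreal (1 / Y x) * nn_cond_exp Q F (\<lambda>x. g x * ennreal (Z x)) x"
    using one by eventually_elim simp
  then have "AE x in Q. nn_cond_exp ?N F g x = nn_cond_exp Q F g x \<longleftrightarrow>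
      nn_cond_exp Q F (\<lambda>x. g x * ennreal (Z x)) x = ennreal (Y x) * nn_cond_exp Q F g x"
    using AE_space
  proof eventually_elim
    case (elim x)
    have y: "ennreal (Y x) * ennreal (1 / Y x) = 1"
      using Y_pos[OF elim(2)] by (simp add: ennreal_mult[symmetric])
    have y0: "ennreal (Y x) \<noteq> 0" "ennreal (Y x) \<noteq> top"
      using Y_pos[OF elim(2)] by auto
    have "ennreal (Y x) * nn_cond_exp ?N F g x = nn_cond_exp Q F (\<lambda>x. g x * ennreal (Z x)) x"
      using elim(1) y by (simp add: mult.assoc[symmetric])
    with y0 show ?case by (metis ennreal_mult_cancel_left)
  qed
  then show ?thesis by (rule AE_iff_cong)
qed

section \<open>Martingales closed by their terminal value\<close>

text \<open>
  By the tower property it suffices to compare each \<open>Y t\<close> with the terminal value; the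
  integrability of \<open>Y t\<close> is then inherited from \<open>Y T\<close>.
\<close>

lemma martingale_on_iff_closed:
  assumes "prob_space R" and sub: "\<And>t. t \<in> I \<Longrightarrow> subalgebra R (F t)"
    and mono: "\<And>s t. s \<in> I \<Longrightarrow> t \<in> I \<Longrightarrow> s \<le> t \<Longrightarrow> sets (F s) \<subseteq> sets (F t)"
    and T: "T \<in> I" "\<And>t. t \<in> I \<Longrightarrow> t \<le> T"
    and Y: "adapted_on I F Y"
    and nonneg: "\<And>t x. t \<in> I \<Longrightarrow> x \<in> space R \<Longrightarrow> 0 \<le> Y t x"
  shows "martingale_on I R F Y \<longleftrightarrow> integrable R (Y T) \<and>
    (\<forall>t\<in>I. AE x in R. nn_cond_exp R (F t) (\<lambda>x. ennreal (Y T x)) x = ennreal (Y t x))"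
proof -
  interpret R: prob_space R by fact
  have RF: "finite_measure_subalgebra R (F t)" if "t \<in> I" for t
    using sub[OF that] by unfold_locales
  have meas: "Y t \<in> borel_measurable R" if "t \<in> I" for t
    using Y sub that by (auto simp: adapted_on_def intro: measurable_from_subalg)
  have closed: "(AE x in R. nn_cond_exp R (F t) (\<lambda>x. ennreal (Y T x)) x = ennreal (Y t x))
      \<longleftrightarrow> (AE x in R. real_cond_exp R (F t) (Y T) x = Y t x)"
    if t: "t \<in> I" and int: "integrable R (Y T)" for t
  proof -
    interpret RFt: finite_measure_subalgebra R "F t" by (rule RF[OF t])
    have [measurable]: "Y T \<in> borel_measurable R" by (rule meas[OF T(1)])
    have "AE x in R. nn_cond_exp R (F t) (\<lambda>x. ennreal (Y T x)) x = ennreal (real_cond_exp R (F t) (Y T) x)"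
      using nonneg T by (intro RFt.nn_cond_exp_eq_real_cond_exp[OF int]) auto
    moreover have "AE x in R. 0 \<le> real_cond_exp R (F t) (Y T) x"
      using nonneg T by (intro RFt.real_cond_exp_pos) auto
    ultimately have "AE x in R. nn_cond_exp R (F t) (\<lambda>x. ennreal (Y T x)) x = ennreal (Y t x)
        \<longleftrightarrow> real_cond_exp R (F t) (Y T) x = Y t x"
      using AE_space
      by eventually_elim (use nonneg[OF t] in simp)
    then show ?thesis by (rule AE_iff_cong)
  qed
  show ?thesis
  proof
    assume mart: "martingale_on I R F Y"
    then have int: "integrable R (Y T)" using T by (simp add: martingale_on_def)
    with mart T show "integrable R (Y T) \<and>
        (\<forall>t\<in>I. AE x in R. nn_cond_exp R (F t) (\<lambda>x. ennreal (Y T x)) x = ennreal (Y t x))"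
      by (simp add: closed martingale_on_def)
  next
    assume R: "integrable R (Y T) \<and>
        (\<forall>t\<in>I. AE x in R. nn_cond_exp R (F t) (\<lambda>x. ennreal (Y T x)) x = ennreal (Y t x))"
    then have int: "integrable R (Y T)" and
      cond: "\<And>t. t \<in> I \<Longrightarrow> AE x in R. real_cond_exp R (F t) (Y T) x = Y t x"
      by (auto simp: closed)
    have int_t: "integrable R (Y t)" if t: "t \<in> I" for t
    proof -
      interpret RFt: finite_measure_subalgebra R "F t" by (rule RF[OF t])
      have "integrable R (real_cond_exp R (F t) (Y T))" by (rule RFt.real_cond_exp_int[OF int])
      then show ?thesis
        using cond[OF t] meas[OF t] by (subst integrable_cong_AE[symmetric]) auto
    qed
    have "AE x in R. real_cond_exp R (F s) (Y t) x = Y s x"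
      if st: "s \<in> I" "t \<in> I" "s \<le> t" for s t
    proof -
      interpret RFs: finite_measure_subalgebra R "F s" by (rule RF[OF st(1)])
      have "AE x in R. real_cond_exp R (F s) (real_cond_exp R (F t) (Y T)) x = real_cond_exp R (F s) (Y T) x"
      proof (rule RFs.real_cond_exp_nested_subalg[OF sub[OF st(2)] _ int])
        show "subalgebra (F t) (F s)"
          using sub[OF st(1)] sub[OF st(2)] mono[OF st] by (simp add: subalgebra_def)
      qed
      moreover have "AE x in R. real_cond_exp R (F s) (real_cond_exp R (F t) (Y T)) x = real_cond_exp R (F s) (Y t) x"
        using cond[OF st(2)] meas[OF st(2)] by (intro RFs.real_cond_exp_cong) auto
      ultimately show ?thesis using cond[OF st(1)] by eventually_elim simp
    qed
    with Y int_t show "martingale_on I R F Y" by (simp add: martingale_on_def)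
  qed
qed

section \<open>Trivial sigma-algebras\<close>

text \<open>
  On a trivial sigma-algebra the constant mean of \<open>f\<close> is a version of its conditional
  expectation, since it only has to be tested on sets of measure zero or one; but an
  \<open>F\<close>-measurable \<open>f\<close> is its own conditional expectation.
\<close>

lemma integrable_const_AE_of_trivial_subalgebra:
  fixes f :: "'a \<Rightarrow> real"
  assumes "prob_space Q" and sub: "subalgebra Q F"
    and triv: "\<And>A. A \<in> sets F \<Longrightarrow> measure Q A = 0 \<or> measure Q A = 1"
    and f: "f \<in> borel_measurable F" "integrable Q f"
  shows "AE x in Q. f x = (\<integral>y. f y \<partial>Q)"
proof -
  interpret Q: prob_space Q by fact
  interpret QF: finite_measure_subalgebra Q F using sub by unfold_locales
  have [measurable]: "f \<in> borel_measurable Q" using f by simp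
  have "AE x in Q. real_cond_exp Q F f x = (\<integral>y. f y \<partial>Q)"
  proof (rule QF.real_cond_exp_charact)
    fix A assume A: "A \<in> sets F"
    then have AQ [measurable]: "A \<in> sets Q" using sub by (auto simp: subalgebra_def)
    from triv[OF A] show "(\<integral>x\<in>A. f x \<partial>Q) = (\<integral>x\<in>A. (\<integral>y. f y \<partial>Q) \<partial>Q)"
    proof
      assume "measure Q A = 0"
      then have "AE x in Q. x \<notin> A" using Q.prob_eq_0[of A] AQ by simp
      then have "(\<integral>x\<in>A. h x \<partial>Q) = (\<integral>x. 0 \<partial>Q)" if "h \<in> borel_measurable Q" for h :: "_ \<Rightarrow> real"
        using that unfolding set_lebesgue_integral_def by (intro integral_cong_AE) auto
      from this[of f] this[of "\<lambda>_. \<integral>y. f y \<partial>Q"] show ?thesis by simp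
    next
      assume "measure Q A = 1"
      then have "AE x in Q. x \<in> A" using Q.prob_eq_1[of A] AQ by simp
      then have "(\<integral>x\<in>A. h x \<partial>Q) = (\<integral>x. h x \<partial>Q)" if "h \<in> borel_measurable Q" for h :: "_ \<Rightarrow> real"
        using that unfolding set_lebesgue_integral_def by (intro integral_cong_AE) auto
      from this[of f] this[of "\<lambda>_. \<integral>y. f y \<partial>Q"] show ?thesis by (simp add: Q.prob_space)
    qed
  qed (use f in auto)
  moreover have "AE x in Q. real_cond_exp Q F f x = f x"
    using f by (intro QF.real_cond_exp_F_meas)
  ultimately show ?thesis by eventually_elim simp
qed

lemma (in prob_space) sigma_sets_zero_one:
  assumes "A \<in> sigma_sets (space M) {N \<in> events. prob N = 0 \<or> prob N = 1}"
  shows "A \<in> events \<and> (prob A = 0 \<or> prob A = 1)"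
  using assms
proof induction
  case (Compl a)
  then show ?case by (auto simp: prob_compl)
next
  case (Union a)
  then have ev: "range a \<subseteq> events" by auto
  show ?case
  proof (cases "\<exists>i. prob (a i) = 1")
    case True
    then obtain i where i: "prob (a i) = 1" by auto
    have "prob (a i) \<le> prob (\<Union>i. a i)" using ev by (intro finite_measure_mono) auto
    with i ev show ?thesis by (auto intro: antisym)
  next
    case False
    with Union have "\<And>i. prob (a i) = 0" by auto
    with ev have "prob (\<Union>i. a i) = 0" by (intro measure_countably_zero)
    with ev show ?thesis by auto
  qed
qed auto

section \<open>Densities of equivalent martingale measures\<close>

text \<open>
  The Radon-Nikodym derivative is positive only almost surely; redefining it as one on the
  exceptional null set gives a density that is positive everywhere.
\<close>

lemma equivalent_measures_imp_pos_density:
  assumes "prob_space Q" "prob_space R" "equivalent_measures Q R"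
  obtains g :: "'a \<Rightarrow> real" where "g \<in> borel_measurable Q" "\<And>x. 0 < g x"
    "R = density Q (\<lambda>x. ennreal (g x))"
proof -
  interpret Q: prob_space Q by fact
  interpret R: prob_space R by fact
  have sets: "sets R = sets Q" and QR: "absolutely_continuous Q R" and RQ: "absolutely_continuous R Q"
    using assms(3) by (auto simp: equivalent_measures_def)
  obtain D where [measurable]: "D \<in> borel_measurable Q"
    and D: "AE x in Q. RN_deriv Q R x = ennreal (D x)" "AE x in R. 0 < D x"
    using Q.real_RN_deriv[OF R.finite_measure_axioms QR sets] by metis
  let ?g = "\<lambda>x. if 0 < D x then D x else 1"
  have "AE x in Q. 0 < D x"
    using D(2) by (rule absolutely_continuous_AE[OF sets[symmetric] RQ])
  with D(1) have "AE x in Q. RN_deriv Q R x = ennreal (?g x)"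
    by eventually_elim simp
  then have "density Q (RN_deriv Q R) = density Q (\<lambda>x. ennreal (?g x))"
    by (intro density_cong) auto
  then have "R = density Q (\<lambda>x. ennreal (?g x))"
    using Q.density_RN_deriv[OF QR sets] by simp
  then show ?thesis by (intro that[of ?g]) auto
qed

lemma prob_space_normalized_density:
  assumes g: "integrable Q g" and g_pos: "\<And>x. x \<in> space Q \<Longrightarrow> 0 < g x"
    and m: "0 < (\<integral>x. g x \<partial>Q)"
  shows "prob_space (density Q (\<lambda>x. ennreal (g x / (\<integral>x. g x \<partial>Q))))"
proof (rule prob_spaceI)
  let ?m = "\<integral>x. g x \<partial>Q"
  have [measurable]: "g \<in> borel_measurable Q" using g by simp
  have "(\<integral>\<^sup>+x. ennreal (g x / ?m) \<partial>Q) = ennreal (\<integral>x. g x / ?m \<partial>Q)"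
    using g g_pos m by (intro nn_integral_eq_integral) (auto intro!: AE_I2 divide_nonneg_pos less_imp_le)
  also have "\<dots> = 1" using m by simp
  finally show "emeasure (density Q (\<lambda>x. ennreal (g x / ?m))) (space (density Q (\<lambda>x. ennreal (g x / ?m)))) = 1"
    by (simp add: emeasure_density cong: nn_integral_cong)
qed

lemma equivalent_measures_density:
  assumes [measurable]: "g \<in> borel_measurable Q" and "\<And>x. x \<in> space Q \<Longrightarrow> 0 < g x"
    and "equivalent_measures P Q"
  shows "equivalent_measures P (density Q (\<lambda>x. ennreal (g x)))"
proof -
  have "null_sets (density Q (\<lambda>x. ennreal (g x))) = null_sets Q"
  proof (rule set_eqI)
    fix A
    have "A \<in> null_sets (density Q (\<lambda>x. ennreal (g x))) \<longleftrightarrow>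
        A \<in> sets Q \<and> (AE x in Q. x \<in> A \<longrightarrow> ennreal (g x) = 0)"
      by (rule null_sets_density_iff) simp
    also have "\<dots> \<longleftrightarrow> A \<in> sets Q \<and> (AE x in Q. x \<notin> A)"
      using assms(2) by (intro conj_cong refl AE_cong) (auto simp: ennreal_eq_0_iff not_le[symmetric])
    also have "\<dots> \<longleftrightarrow> A \<in> null_sets Q"
      using AE_iff_null_sets by blast
    finally show "A \<in> null_sets (density Q (\<lambda>x. ennreal (g x))) \<longleftrightarrow> A \<in> null_sets Q" .
  qed
  with assms(3) show ?thesis
    by (simp add: equivalent_measures_def absolutely_continuous_def)
qed

text \<open>
  The two readings of Bayes' formula meet here. The closing condition is used twice: under \<open>Q\<close>
  it supplies the hypothesis on \<open>Z = X i T\<close> and \<open>Y = X i t\<close> needed for the complementary measures,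
  and under the new measure it is what has to be characterized.
\<close>

lemma normalized_density_martingale_measure_iff:
  assumes I: "I \<subseteq> {0..T}" "T \<in> I"
    and filt: "filtration_on I P F"
    and adapted: "\<And>i. i \<in> {1..d} \<Longrightarrow> adapted_on I F (X i)"
    and X_pos: "\<And>i t \<omega>. i \<in> {1..d} \<Longrightarrow> t \<in> I \<Longrightarrow> \<omega> \<in> space P \<Longrightarrow> 0 < X i t \<omega>"
    and Q: "Q \<in> martingale_measures I P F d X"
    and g: "integrable Q g" and g_pos: "\<And>x. x \<in> space Q \<Longrightarrow> 0 < g x"
    and m: "m = (\<integral>x. g x \<partial>Q)" "0 < m"
  shows "density Q (\<lambda>x. ennreal (g x / m)) \<in> martingale_measures I P F d X \<longleftrightarrow>
    (\<forall>i\<in>{1..d}. integrable Q (\<lambda>x. X i T x * g x)) \<and>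
    (\<forall>i\<in>{1..d}. \<forall>t\<in>I. AE \<omega> in Q.
       nn_cond_exp (complementary_measure T Q (X i) t) (F t) (\<lambda>\<omega>. ennreal (g \<omega>)) \<omega>
       = nn_cond_exp Q (F t) (\<lambda>\<omega>. ennreal (g \<omega>)) \<omega>)"
    (is "?R \<in> _ \<longleftrightarrow> _")
proof -
  have Q_prob: "prob_space Q" and PQ: "equivalent_measures P Q"
    and Q_mart: "\<And>i. i \<in> {1..d} \<Longrightarrow> martingale_on I Q F (X i)"
    using Q by (auto simp: martingale_measures_def)
  have sets: "sets Q = sets P" using PQ by (simp add: equivalent_measures_def)
  then have space: "space Q = space P" by (rule sets_eq_imp_space_eq)
  have [measurable]: "g \<in> borel_measurable Q" using g by simp
  have sub: "subalgebra Q (F t)" if "t \<in> I" for t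
    using filt that sets space by (simp add: filtration_on_def subalgebra_def)
  have R_prob: "prob_space ?R"
    unfolding m(1) by (rule prob_space_normalized_density[OF g g_pos m(2)[unfolded m(1)]])
  have R_equiv: "equivalent_measures P ?R"
    using PQ g_pos m(2) by (intro equivalent_measures_density) auto
  have X_meas: "X i t \<in> borel_measurable Q" if "i \<in> {1..d}" "t \<in> I" for i t
    using adapted[OF that(1)] sub[OF that(2)] that(2)
    by (auto simp: adapted_on_def intro: measurable_from_subalg)
  have closed: "martingale_on I N F (X i) \<longleftrightarrow> integrable N (X i T) \<and>
      (\<forall>t\<in>I. AE x in N. nn_cond_exp N (F t) (\<lambda>x. ennreal (X i T x)) x = ennreal (X i t x))"
    if i: "i \<in> {1..d}" and N: "prob_space N" "sets N = sets P" for i N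
  proof (rule martingale_on_iff_closed[OF N(1)])
    have "space N = space P" using N(2) by (rule sets_eq_imp_space_eq)
    then show "subalgebra N (F t)" if "t \<in> I" for t
      using filt that N(2) by (simp add: filtration_on_def subalgebra_def)
    show "0 \<le> X i t x" if "t \<in> I" "x \<in> space N" for t x
      using X_pos[OF i that(1)] that(2) \<open>space N = space P\<close> by (simp add: less_imp_le)
  qed (use filt I adapted[OF i] in \<open>auto simp: filtration_on_def\<close>)
  have int: "integrable ?R (X i T) \<longleftrightarrow> integrable Q (\<lambda>x. X i T x * g x)" if i: "i \<in> {1..d}" for i
  proof -
    have [measurable]: "X i T \<in> borel_measurable Q" by (rule X_meas[OF i I(2)])
    have "integrable ?R (X i T) \<longleftrightarrow> integrable Q (\<lambda>x. (g x / m) *\<^sub>R X i T x)"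
      using g_pos m(2) by (intro integrable_density) (auto intro!: AE_I2 divide_nonneg_pos less_imp_le)
    also have "(\<lambda>x. (g x / m) *\<^sub>R X i T x) = (\<lambda>x. (1 / m) * (X i T x * g x))"
      by (simp add: mult.commute)
    also have "integrable Q \<dots> \<longleftrightarrow> integrable Q (\<lambda>x. X i T x * g x)"
      using m(2) by (subst integrable_mult_left_iff) simp
    finally show ?thesis .
  qed
  have cond: "(AE x in ?R. nn_cond_exp ?R (F t) (\<lambda>x. ennreal (X i T x)) x = ennreal (X i t x)) \<longleftrightarrow>
      (AE \<omega> in Q. nn_cond_exp (complementary_measure T Q (X i) t) (F t) (\<lambda>\<omega>. ennreal (g \<omega>)) \<omega>
       = nn_cond_exp Q (F t) (\<lambda>\<omega>. ennreal (g \<omega>)) \<omega>)"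
    if i: "i \<in> {1..d}" and t: "t \<in> I" for i t
  proof -
    have Z: "X i T \<in> borel_measurable Q" by (rule X_meas[OF i I(2)])
    have Y: "X i t \<in> borel_measurable (F t)"
      using adapted[OF i] t by (simp add: adapted_on_def)
    have "AE x in Q. nn_cond_exp Q (F t) (\<lambda>x. ennreal (X i T x)) x = ennreal (X i t x)"
      using closed[OF i Q_prob sets] Q_mart[OF i] t by simp
    then show ?thesis
      unfolding complementary_measure_def
      using X_pos[OF i] t I(2) space
      by (subst complementary_cond_exp_eq_iff[OF Q_prob sub[OF t] Z Y])
         (auto intro!: less_imp_le cond_exp_normalized_density_eq_iff[OF Q_prob sub[OF t] Z g g_pos m(2) R_prob])
  qed
  show ?thesis
    using R_prob R_equiv sets by (auto simp: martingale_measures_def closed int cond)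
qed

section \<open>Uniqueness of the equivalent martingale measure\<close>

lemma integrable_numeraire_measure_iff:
  fixes g :: "'a \<Rightarrow> real"
  assumes [measurable]: "Y 0 \<in> borel_measurable Q" "Y T \<in> borel_measurable Q" "g \<in> borel_measurable Q"
    and pos: "\<And>x. x \<in> space Q \<Longrightarrow> 0 < Y 0 x" "\<And>x. x \<in> space Q \<Longrightarrow> 0 < Y T x"
    and c: "AE x in Q. Y 0 x = c" "c \<noteq> 0"
  shows "integrable (numeraire_measure T Q Y) g \<longleftrightarrow> integrable Q (\<lambda>x. Y T x * g x)"
proof -
  have "integrable (numeraire_measure T Q Y) g \<longleftrightarrow> integrable Q (\<lambda>x. (Y T x / Y 0 x) *\<^sub>R g x)"
    unfolding numeraire_measure_def
    using pos by (intro integrable_density AE_I2) (simp_all add: less_imp_le)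
  also have "\<dots> \<longleftrightarrow> integrable Q (\<lambda>x. (1 / c) * (Y T x * g x))"
    using c(1) by (intro integrable_cong_AE) auto
  also have "\<dots> \<longleftrightarrow> integrable Q (\<lambda>x. Y T x * g x)"
    using c(2) by (subst integrable_mult_left_iff) simp
  finally show ?thesis .
qed

theorem theorem4p8:
  fixes T :: real and I :: "real set" and P Q :: "'a measure"
    and F :: "real \<Rightarrow> 'a measure" and d :: nat
    and X :: "nat \<Rightarrow> real \<Rightarrow> 'a \<Rightarrow> real"
  assumes "0 < T" and "I \<subseteq> {0..T}" and "{0, T} \<subseteq> I"
    and "prob_space P"
    and "filtration_on I P F"
    and "sets P = sigma_sets (space P) (\<Union>t\<in>I. sets (F t))"
    and "sets (F 0) =
           sigma_sets (space P) {N \<in> sets P. measure P N = 0 \<or> measure P N = 1}"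
    and "\<And>i. i \<in> {1..d} \<Longrightarrow> adapted_on I F (X i)"
    and "\<And>i t \<omega>. i \<in> {1..d} \<Longrightarrow> t \<in> I \<Longrightarrow> \<omega> \<in> space P \<Longrightarrow> 0 < X i t \<omega>"
    and "Q \<in> martingale_measures I P F d X"
  shows "martingale_measures I P F d X = {Q} \<longleftrightarrow>
    (\<forall>g \<in> positive_integrands T Q d X.
       (\<forall>i\<in>{1..d}. \<forall>t\<in>I. AE \<omega> in Q.
          nn_cond_exp (complementary_measure T Q (X i) t) (F t) (\<lambda>\<omega>. ennreal (g \<omega>)) \<omega>
          = nn_cond_exp Q (F t) (\<lambda>\<omega>. ennreal (g \<omega>)) \<omega>)
       \<longrightarrow> (\<exists>c. AE \<omega> in Q. g \<omega> = c))"
    (is "?unique \<longleftrightarrow> (\<forall>g\<in>?G. ?compl g \<longrightarrow> ?const g)")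
proof -
  have T: "T \<in> I" and zero: "0 \<in> I" using assms(3) by auto
  have "prob_space Q" and PQ: "equivalent_measures P Q"
    and Q_mart: "\<And>i. i \<in> {1..d} \<Longrightarrow> martingale_on I Q F (X i)"
    using assms(10) by (auto simp: martingale_measures_def)
  interpret P: prob_space P by fact
  interpret Q: prob_space Q by fact
  have sets: "sets Q = sets P" and ac: "absolutely_continuous P Q"
    using PQ by (simp_all add: equivalent_measures_def)
  have space: "space Q = space P" using sets by (rule sets_eq_imp_space_eq)
  have sub: "subalgebra Q (F t)" if "t \<in> I" for t
    using assms(5) that sets space by (simp add: filtration_on_def subalgebra_def)
  have X_meas: "X i t \<in> borel_measurable Q" if "i \<in> {1..d}" "t \<in> I" for i t
    using assms(8)[OF that(1)] sub[OF that(2)] that(2)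
    by (auto simp: adapted_on_def intro: measurable_from_subalg)

  \<comment> \<open>\<open>F 0\<close> is trivial with respect to \<open>P\<close>; equivalence carries this over to \<open>Q\<close>.\<close>
  have triv: "measure Q A = 0 \<or> measure Q A = 1" if "A \<in> sets (F 0)" for A
  proof -
    have A: "A \<in> sets P" "measure P A = 0 \<or> measure P A = 1"
      using P.sigma_sets_zero_one[OF that[unfolded assms(7)]] by simp_all
    then have "(AE x in P. x \<notin> A) \<or> (AE x in P. x \<in> A)"
      using P.prob_eq_0[of A] P.prob_eq_1[of A] by auto
    then have "(AE x in Q. x \<notin> A) \<or> (AE x in Q. x \<in> A)"
      using absolutely_continuous_AE[OF sets ac] by blast
    then show ?thesis
      using Q.prob_eq_0[of A] Q.prob_eq_1[of A] A(1) sets by auto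
  qed
  have X0: "\<exists>c. c \<noteq> 0 \<and> (AE x in Q. X i 0 x = c)" if i: "i \<in> {1..d}" for i
  proof -
    have ae: "AE x in Q. X i 0 x = (\<integral>y. X i 0 y \<partial>Q)"
      using Q_mart[OF i] zero
      by (intro integrable_const_AE_of_trivial_subalgebra[OF \<open>prob_space Q\<close> sub[OF zero] triv])
         (auto simp: martingale_on_def adapted_on_def)
    moreover have "0 < (\<integral>y. X i 0 y \<partial>Q)"
    proof (rule Q.expectation_greater)
      show "integrable Q (X i 0)" using Q_mart[OF i] zero by (simp add: martingale_on_def)
      show "AE x in Q. 0 < X i 0 x" using assms(9)[OF i zero] space by (intro AE_I2) simp
    qed
    ultimately show ?thesis by (intro exI[of _ "\<integral>y. X i 0 y \<partial>Q"]) simp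
  qed
  have G_iff: "g \<in> ?G \<longleftrightarrow> (\<forall>x\<in>space Q. 0 < g x) \<and> integrable Q g \<and>
      (\<forall>i\<in>{1..d}. integrable Q (\<lambda>x. X i T x * g x))" for g
  proof -
    have "integrable (numeraire_measure T Q (X i)) g \<longleftrightarrow> integrable Q (\<lambda>x. X i T x * g x)"
      if i: "i \<in> {1..d}" and g: "integrable Q g" for i
    proof -
      obtain c where c: "c \<noteq> 0" "AE x in Q. X i 0 x = c" using X0[OF i] by blast
      show ?thesis
      proof (rule integrable_numeraire_measure_iff[OF X_meas[OF i zero] X_meas[OF i T] _ _ _ c(2,1)])
        show "0 < X i 0 x" "0 < X i T x" if "x \<in> space Q" for x
          using assms(9)[OF i zero] assms(9)[OF i T] that space by simp_all
      qed (use g in simp)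
    qed
    then show ?thesis by (auto simp: positive_integrands_def)
  qed
  have density_iff: "density Q (\<lambda>x. ennreal (g x / m)) \<in> martingale_measures I P F d X
      \<longleftrightarrow> g \<in> ?G \<and> ?compl g"
    if "integrable Q g" "\<And>x. x \<in> space Q \<Longrightarrow> 0 < g x" "m = (\<integral>x. g x \<partial>Q)" "0 < m" for g m
    using normalized_density_martingale_measure_iff[OF assms(2) T assms(5,8,9,10) that] that
    by (auto simp: G_iff)

  show ?thesis
  proof
    \<comment> \<open>A non-constant \<open>g\<close>, normalized to mean one, would be the density of a second martingale measure.\<close>
    assume unique: ?unique
    show "\<forall>g\<in>?G. ?compl g \<longrightarrow> ?const g"
    proof (intro ballI impI)
      fix g assume g: "g \<in> ?G" and compl: "?compl g"
      have int: "integrable Q g" and pos: "\<And>x. x \<in> space Q \<Longrightarrow> 0 < g x"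
        using g by (auto simp: G_iff)
      have [measurable]: "g \<in> borel_measurable Q" using int by simp
      define m where "m = (\<integral>x. g x \<partial>Q)"
      have "0 < m"
        unfolding m_def using int pos by (intro Q.expectation_greater) auto
      then have "density Q (\<lambda>x. ennreal (g x / m)) = Q"
        using density_iff[OF int pos m_def] g compl unique by blast
      then have "density Q (\<lambda>x. ennreal (g x / m)) = density Q (\<lambda>_. 1)" by (simp add: density_1)
      then have "AE x in Q. ennreal (g x / m) = 1"
        by (subst (asm) Q.density_unique_iff) auto
      then have "AE x in Q. g x = m"
        by eventually_elim (use \<open>0 < m\<close> in simp)
      then show "?const g" by blast
    qed
  next
    \<comment> \<open>The density of any other martingale measure is an admissible \<open>g\<close> of mean one.\<close>
    assume compl: "\<forall>g\<in>?G. ?compl g \<longrightarrow> ?const g"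
    have "R = Q" if R: "R \<in> martingale_measures I P F d X" for R
    proof -
      have "prob_space R" and PR: "equivalent_measures P R"
        using R by (auto simp: martingale_measures_def)
      interpret R: prob_space R by fact
      have "equivalent_measures Q R"
        using PQ PR by (auto simp: equivalent_measures_def absolutely_continuous_def)
      then obtain g where g [measurable]: "g \<in> borel_measurable Q" and pos: "\<And>x. 0 < g x"
        and R_eq: "R = density Q (\<lambda>x. ennreal (g x))"
        using equivalent_measures_imp_pos_density[OF \<open>prob_space Q\<close> \<open>prob_space R\<close>] by metis
      have one: "(\<integral>\<^sup>+x. ennreal (g x) \<partial>Q) = 1"
        using R.emeasure_space_1 unfolding R_eq
        by (simp add: emeasure_density cong: nn_integral_cong)
      have int: "integrable Q g"
        using one pos by (intro integrableI_nonneg) (auto intro: less_imp_le)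
      have "(\<integral>x. g x \<partial>Q) = 1"
        using one pos by (subst integral_eq_nn_integral) (auto intro: less_imp_le)
      then have "g \<in> ?G" "?compl g"
        using density_iff[OF int pos, of 1] R unfolding R_eq by simp_all
      with compl obtain c where c: "AE x in Q. g x = c" by blast
      then have "(\<integral>x. g x \<partial>Q) = (\<integral>x. c \<partial>Q)" by (intro integral_cong_AE) auto
      with \<open>(\<integral>x. g x \<partial>Q) = 1\<close> have "c = 1" by (simp add: Q.prob_space)
      have "density Q (\<lambda>x. ennreal (g x)) = density Q (\<lambda>_. 1)"
        using c \<open>c = 1\<close> by (intro density_cong) auto
      then show ?thesis by (simp add: R_eq density_1)
    qed
    with assms(10) show ?unique by blast
  qed
qed

end
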